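(* Let $f\colon P\to Q$ be a surjective quandle homomorphism. Then $f$ is strongly connected if and only if it is isomorphic, as a quotient of $P$, to the quotient map $\pi_N\colon P\to P/N$ by a normal subgroup $N\subseteq\mathrm{Inn}(P)$ that is $\mathrm{Inn}(P)$-perfect, i.e. $[\mathrm{Inn}(P),N]=N$. Moreover, for any quandle $P$ there is a one-to-one correspondence between isomorphism classes of strongly connected quotients of $P$ and $\mathrm{Inn}(P)$-perfect normal subgroups of $\mathrm{Inn}(P)$, given by sending a strongly connected surjection $f$ to $\mathrm{Trans}_{\mathrm{rel}}(f)$ and an $\mathrm{Inn}(P)$-perfect normal subgroup $N$ to $\pi_N\colon P\to P/N$.
   Context: A quandle is a set $Q$ with bijections $s_x\colon Q\to Q$ ($x\in Q$) such that $s_x(x)=x$ and $s_x\circ s_y=s_{s_x(y)}\circ s_x$ for all $x,y\in Q$. A quandle homomorphism $f\colon P\to Q$ is a map with $f(s_x(y))=s_{f(x)}(f(y))$ for all $x,y\in P$. The inner automorphism group $\mathrm{Inn}(P)$ is the group of permutations of $P$ generated by all $s_x$, $x\in P$. For a surjective quandle homomorphism $f\colon P\to Q$, the relative transvection group is $\mathrm{Trans}_{\mathrm{rel}}(f)=\langle s_xs_y^{-1}\mid x,y\in P,\ f(x)=f(y)\rangle$, a normal subgroup of $\mathrm{Inn}(P)$ that preserves each fiber of $f$. The homomorphism $f$ is strongly connected if it is surjective and $\mathrm{Trans}_{\mathrm{rel}}(f)$ acts transitively on every fiber of $f$. For a normal subgroup $N$ of $\mathrm{Inn}(P)$, $P/N$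 denotes the set of $N$-orbits in $P$ with the (well-defined) quandle structure $s_{[x]}([y])=[s_x(y)]$, and $\pi_N\colon P\to P/N$ is the natural quotient homomorphism. Two surjective homomorphisms $f\colon P\to Q$ and $f'\colon P\to Q'$ are isomorphic as quotients of $P$ if there is a quandle isomorphism $\theta\colon Q\to Q'$ with $\theta\circ f=f'$; a strongly connected quotient of $P$ is a strongly connected homomorphism with domain $P$. *)

theory Defs
  imports "HOL-Algebra.Algebra"
begin

record 'a quandle = "'a partial_object" +
  qsym :: "'a \<Rightarrow> 'a \<Rightarrow> 'a"

locale quandle =
  fixes Q :: "('a, 'm) quandle_scheme"
  assumes qsym_bij: "x \<in> carrier Q \<Longrightarrow> bij_betw (qsym Q x) (carrier Q) (carrier Q)"
    and qsym_idem: "x \<in> carrier Q \<Longrightarrow> qsym Q x x = x"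
    and qsym_distrib: "\<lbrakk>x \<in> carrier Q; y \<in> carrier Q; z \<in> carrier Q\<rbrakk> \<Longrightarrow>
      qsym Q x (qsym Q y z) = qsym Q (qsym Q x y) (qsym Q x z)"

locale quandle_hom = dom: quandle P + cod: quandle Q
  for P :: "('a, 'm) quandle_scheme" and Q :: "('b, 'n) quandle_scheme" +
  fixes f :: "'a \<Rightarrow> 'b"
  assumes hom_closed: "f \<in> carrier P \<rightarrow> carrier Q"
    and hom_qsym: "\<lbrakk>x \<in> carrier P; y \<in> carrier P\<rbrakk> \<Longrightarrow> f (qsym P x y) = qsym Q (f x) (f y)"

definition surj_quandle_hom ::
  "('a, 'm) quandle_scheme \<Rightarrow> ('b, 'n) quandle_scheme \<Rightarrow> ('a \<Rightarrow> 'b) \<Rightarrow> bool" where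
  "surj_quandle_hom P Q f \<longleftrightarrow> quandle_hom P Q f \<and> f ` carrier P = carrier Q"

definition quandle_iso ::
  "('a, 'm) quandle_scheme \<Rightarrow> ('b, 'n) quandle_scheme \<Rightarrow> ('a \<Rightarrow> 'b) \<Rightarrow> bool" where
  "quandle_iso P Q f \<longleftrightarrow> quandle_hom P Q f \<and> bij_betw f (carrier P) (carrier Q)"

text \<open>The elements of \<^term>\<open>BijGroup S\<close> are extensional, so \<^term>\<open>qsym P x\<close> has to be
  restricted to the carrier to become one of them.\<close>

definition qperm :: "('a, 'm) quandle_scheme \<Rightarrow> 'a \<Rightarrow> 'a \<Rightarrow> 'a" where
  "qperm P x = restrict (qsym P x) (carrier P)"

definition Inn :: "('a, 'm) quandle_scheme \<Rightarrow> ('a \<Rightarrow> 'a) monoid" where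
  "Inn P = subgroup_generated (BijGroup (carrier P)) (qperm P ` carrier P)"

definition Trans_rel :: "('a, 'm) quandle_scheme \<Rightarrow> ('a \<Rightarrow> 'b) \<Rightarrow> ('a \<Rightarrow> 'a) set" where
  "Trans_rel P f = generate (Inn P)
     {qperm P x \<otimes>\<^bsub>Inn P\<^esub> inv\<^bsub>Inn P\<^esub> (qperm P y) | x y.
        x \<in> carrier P \<and> y \<in> carrier P \<and> f x = f y}"

definition strongly_connected ::
  "('a, 'm) quandle_scheme \<Rightarrow> ('b, 'n) quandle_scheme \<Rightarrow> ('a \<Rightarrow> 'b) \<Rightarrow> bool" where
  "strongly_connected P Q f \<longleftrightarrow> surj_quandle_hom P Q f \<and>
     (\<forall>x\<in>carrier P. \<forall>y\<in>carrier P. f x = f y \<longrightarrow> (\<exists>g\<in>Trans_rel P f. g x = y))"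

text \<open>The subgroup $[H,K]$; for \<open>H = K\<close> this is \<^const>\<open>derived\<close>.\<close>

definition mutual_commutator :: "('a, 'm) monoid_scheme \<Rightarrow> 'a set \<Rightarrow> 'a set \<Rightarrow> 'a set" where
  "mutual_commutator G H K = generate G
     (\<Union>h\<in>H. \<Union>k\<in>K. {h \<otimes>\<^bsub>G\<^esub> k \<otimes>\<^bsub>G\<^esub> inv\<^bsub>G\<^esub> h \<otimes>\<^bsub>G\<^esub> inv\<^bsub>G\<^esub> k})"

definition Inn_perfect :: "('a, 'm) quandle_scheme \<Rightarrow> ('a \<Rightarrow> 'a) set \<Rightarrow> bool" where
  "Inn_perfect P N \<longleftrightarrow> mutual_commutator (Inn P) (carrier (Inn P)) N = N"

definition perfect_normals :: "('a, 'm) quandle_scheme \<Rightarrow> ('a \<Rightarrow> 'a) set set" where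
  "perfect_normals P = {N. N \<lhd> Inn P \<and> Inn_perfect P N}"

definition quot_map :: "('a, 'm) quandle_scheme \<Rightarrow> ('a \<Rightarrow> 'a) set \<Rightarrow> 'a \<Rightarrow> 'a set" where
  "quot_map P N x = orbit (Inn P\<lparr>carrier := N\<rparr>) (\<lambda>g. g) x"

text \<open>As usual for operations on equivalence classes, the operation on orbits is the union of the
  classes obtained from all representatives; for normal \<^term>\<open>N\<close> these all coincide, see
  lemma \<open>quot_qsym_eq\<close> below.\<close>

definition quot_quandle :: "('a, 'm) quandle_scheme \<Rightarrow> ('a \<Rightarrow> 'a) set \<Rightarrow> 'a set quandle" where
  "quot_quandle P N =
     \<lparr>carrier = orbits (Inn P\<lparr>carrier := N\<rparr>) (carrier P) (\<lambda>g. g),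
      qsym = (\<lambda>A B. \<Union>x\<in>A. \<Union>y\<in>B. quot_map P N (qsym P x y))\<rparr>"

definition quotient_iso ::
  "('a, 'm) quandle_scheme \<Rightarrow> ('b, 'n) quandle_scheme \<Rightarrow> ('a \<Rightarrow> 'b) \<Rightarrow>
     ('c, 'k) quandle_scheme \<Rightarrow> ('a \<Rightarrow> 'c) \<Rightarrow> bool" where
  "quotient_iso P Q f Q' f' \<longleftrightarrow>
     (\<exists>\<theta>. quandle_iso Q Q' \<theta> \<and> (\<forall>x\<in>carrier P. \<theta> (f x) = f' x))"

definition sc_quotients :: "('a, 'm) quandle_scheme \<Rightarrow> ('b quandle \<times> ('a \<Rightarrow> 'b)) set" where
  "sc_quotients P = {(Q, f). strongly_connected P Q f}"

definition sc_quotient_iso_rel ::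
  "('a, 'm) quandle_scheme \<Rightarrow> (('b quandle \<times> ('a \<Rightarrow> 'b)) \<times> ('b quandle \<times> ('a \<Rightarrow> 'b))) set" where
  "sc_quotient_iso_rel P = {((Q, f), (Q', f')). (Q, f) \<in> sc_quotients P \<and>
     (Q', f') \<in> sc_quotients P \<and> quotient_iso P Q f Q' f'}"

text \<open>Isomorphism classes are formed among quotients with codomain carried by one fixed type
  \<open>'b\<close>. Every quotient of a quandle on \<open>'a\<close> is isomorphic to one carried by \<open>'a set\<close> (replace each
  point by its fiber), so \<open>'b = 'a set\<close> already represents all isomorphism classes.\<close>

definition sc_quotient_classes ::
  "('a, 'm) quandle_scheme \<Rightarrow> ('b quandle \<times> ('a \<Rightarrow> 'b)) set set" where
  "sc_quotient_classes P = sc_quotients P // sc_quotient_iso_rel P"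

definition sc_class ::
  "('a, 'm) quandle_scheme \<Rightarrow> 'b quandle \<Rightarrow> ('a \<Rightarrow> 'b) \<Rightarrow> ('b quandle \<times> ('a \<Rightarrow> 'b)) set" where
  "sc_class P Q f = sc_quotient_iso_rel P `` {(Q, f)}"

lemma equiv_sc_quotient_iso_rel:
  fixes P :: "('a, 'm) quandle_scheme"
  shows "equiv (sc_quotients P :: ('b quandle \<times> ('a \<Rightarrow> 'b)) set) (sc_quotient_iso_rel P)"
    (is "equiv ?S ?R")
proof (rule equivI)
  show "?R \<subseteq> ?S \<times> ?S"
    by (auto simp: sc_quotient_iso_rel_def)
  show "refl_on ?S ?R"
  proof (rule refl_onI)
    fix p :: "'b quandle \<times> ('a \<Rightarrow> 'b)"
    assume p: "p \<in> sc_quotients P"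
    obtain Q f where [simp]: "p = (Q, f)" by force
    have "quandle Q" using p
      by (auto simp: sc_quotients_def strongly_connected_def surj_quandle_hom_def quandle_hom_def)
    then have "quandle_iso Q Q id"
      by (auto simp: quandle_iso_def quandle_hom_def quandle_hom_axioms_def)
    then show "(p, p) \<in> sc_quotient_iso_rel P"
      using p by (auto simp: sc_quotient_iso_rel_def quotient_iso_def intro!: exI[of _ id])
  qed
  show "sym ?R"
  proof (rule symI)
    fix p p' :: "'b quandle \<times> ('a \<Rightarrow> 'b)"
    assume pp: "(p, p') \<in> sc_quotient_iso_rel P"
    obtain Q f Q' f' where [simp]: "p = (Q, f)" "p' = (Q', f')" by (metis surj_pair)
    obtain t where t: "quandle_hom Q Q' t" "bij_betw t (carrier Q) (carrier Q')"
      "\<And>x. x \<in> carrier P \<Longrightarrow> t (f x) = f' x"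
      using pp by (auto simp: sc_quotient_iso_rel_def quotient_iso_def quandle_iso_def)
    have f: "f ` carrier P = carrier Q" using pp
      by (auto simp: sc_quotient_iso_rel_def sc_quotients_def strongly_connected_def surj_quandle_hom_def)
    interpret t: quandle_hom Q Q' t by fact
    let ?u = "inv_into (carrier Q) t"
    have u: "?u (t x) = x" if "x \<in> carrier Q" for x
      using t(2) that by (simp add: bij_betw_def inv_into_f_f)
    have tu: "t (?u y) = y" "?u y \<in> carrier Q" if "y \<in> carrier Q'" for y
      using t(2) that by (auto simp: bij_betw_def f_inv_into_f inv_into_into)
    have cl: "qsym Q x y \<in> carrier Q" if "x \<in> carrier Q" "y \<in> carrier Q" for x y
      using t.dom.qsym_bij that by (auto simp: bij_betw_def)
    have "?u (qsym Q' x y) = qsym Q (?u x) (?u y)" if "x \<in> carrier Q'" "y \<in> carrier Q'" for x y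
      by (metis that tu t.hom_qsym u cl)
    then have "quandle_hom Q' Q ?u"
      using tu by unfold_locales auto
    moreover have "bij_betw ?u (carrier Q') (carrier Q)"
      using t(2) by (rule bij_betw_inv_into)
    moreover have "?u (f' x) = f x" if "x \<in> carrier P" for x
      using u[of "f x"] t(3)[OF that] f that by auto
    ultimately show "(p', p) \<in> sc_quotient_iso_rel P"
      using pp by (auto simp: sc_quotient_iso_rel_def quotient_iso_def quandle_iso_def)
  qed
  show "trans ?R"
  proof (rule transI)
    fix p p' p'' :: "'b quandle \<times> ('a \<Rightarrow> 'b)"
    assume pp: "(p, p') \<in> sc_quotient_iso_rel P" "(p', p'') \<in> sc_quotient_iso_rel P"
    obtain Q f Q' f' Q'' f'' where [simp]: "p = (Q, f)" "p' = (Q', f')" "p'' = (Q'', f'')"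
      by (metis surj_pair)
    obtain t where t: "quandle_hom Q Q' t" "bij_betw t (carrier Q) (carrier Q')"
      "\<And>x. x \<in> carrier P \<Longrightarrow> t (f x) = f' x"
      using pp(1) by (auto simp: sc_quotient_iso_rel_def quotient_iso_def quandle_iso_def)
    obtain u where u: "quandle_hom Q' Q'' u" "bij_betw u (carrier Q') (carrier Q'')"
      "\<And>x. x \<in> carrier P \<Longrightarrow> u (f' x) = f'' x"
      using pp(2) by (auto simp: sc_quotient_iso_rel_def quotient_iso_def quandle_iso_def)
    interpret t: quandle_hom Q Q' t by fact
    interpret u: quandle_hom Q' Q'' u by fact
    have "quandle_hom Q Q'' (u \<circ> t)"
      using t.hom_closed u.hom_closed
      by unfold_locales (auto simp: t.hom_qsym u.hom_qsym Pi_iff)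
    moreover have "bij_betw (u \<circ> t) (carrier Q) (carrier Q'')"
      using t(2) u(2) by (rule bij_betw_trans)
    moreover have "(u \<circ> t) (f x) = f'' x" if "x \<in> carrier P" for x
      using t(3) u(3) that by simp
    ultimately have "quotient_iso P Q f Q'' f''"
      unfolding quotient_iso_def quandle_iso_def by blast
    then show "(p, p'') \<in> sc_quotient_iso_rel P"
      using pp by (auto simp: sc_quotient_iso_rel_def)
  qed
qed

context quandle
begin

lemma qperm_in_Bij: "x \<in> carrier Q \<Longrightarrow> qperm Q x \<in> Bij (carrier Q)"
  using qsym_bij by (auto simp: qperm_def Bij_def)

lemma group_Inn: "group (Inn Q)"
  unfolding Inn_def by (rule group.group_subgroup_generated[OF group_BijGroup])

lemma carrier_Inn: "carrier (Inn Q) = generate (BijGroup (carrier Q)) (qperm Q ` carrier Q)"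
proof -
  have "carrier (BijGroup (carrier Q)) \<inter> qperm Q ` carrier Q = qperm Q ` carrier Q"
    using qperm_in_Bij by (auto simp: BijGroup_def)
  then show ?thesis
    by (simp add: Inn_def subgroup_generated_def)
qed

lemma Inn_subset_Bij: "carrier (Inn Q) \<subseteq> Bij (carrier Q)"
  using group.carrier_subgroup_generated_subset[OF group_BijGroup]
  by (simp add: Inn_def BijGroup_def)

lemma mult_Inn:
  "g \<in> carrier (Inn Q) \<Longrightarrow> h \<in> carrier (Inn Q) \<Longrightarrow> g \<otimes>\<^bsub>Inn Q\<^esub> h = compose (carrier Q) g h"
  using Inn_subset_Bij by (auto simp: Inn_def BijGroup_def)

lemma one_Inn: "\<one>\<^bsub>Inn Q\<^esub> = (\<lambda>x\<in>carrier Q. x)"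
  by (simp add: Inn_def BijGroup_def)

lemma Inn_closed: "g \<in> carrier (Inn Q) \<Longrightarrow> x \<in> carrier Q \<Longrightarrow> g x \<in> carrier Q"
  using Inn_subset_Bij by (auto simp: Bij_def bij_betw_def)

lemma qsym_closed: "x \<in> carrier Q \<Longrightarrow> y \<in> carrier Q \<Longrightarrow> qsym Q x y \<in> carrier Q"
  using qsym_bij by (auto simp: bij_betw_def)

lemma inv_Inn:
  assumes "g \<in> carrier (Inn Q)" "x \<in> carrier Q"
  shows "(inv\<^bsub>Inn Q\<^esub> g) (g x) = x" "g ((inv\<^bsub>Inn Q\<^esub> g) x) = x"
proof -
  interpret group "Inn Q" by (rule group_Inn)
  have "inv\<^bsub>Inn Q\<^esub> g \<otimes>\<^bsub>Inn Q\<^esub> g = \<one>\<^bsub>Inn Q\<^esub>" "g \<otimes>\<^bsub>Inn Q\<^esub> inv\<^bsub>Inn Q\<^esub> g = \<one>\<^bsub>Inn Q\<^esub>"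
    using assms by simp_all
  then have "compose (carrier Q) (inv\<^bsub>Inn Q\<^esub> g) g x = x" "compose (carrier Q) g (inv\<^bsub>Inn Q\<^esub> g) x = x"
    using assms by (simp_all add: mult_Inn one_Inn)
  then show "(inv\<^bsub>Inn Q\<^esub> g) (g x) = x" "g ((inv\<^bsub>Inn Q\<^esub> g) x) = x"
    using assms by (simp_all add: compose_eq)
qed

lemma qperm_in_Inn: "x \<in> carrier Q \<Longrightarrow> qperm Q x \<in> carrier (Inn Q)"
  by (auto simp: carrier_Inn intro: generate.incl)

lemma Inn_qsym:
  assumes "g \<in> carrier (Inn Q)" "x \<in> carrier Q" "y \<in> carrier Q"
  shows "g (qsym Q x y) = qsym Q (g x) (g y)"
  using assms(1)[unfolded carrier_Inn] assms(2,3)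
proof (induction g arbitrary: x y rule: generate.induct)
  case one
  then show ?case by (simp add: BijGroup_def qsym_closed)
next
  case (incl h)
  then obtain z where z: "z \<in> carrier Q" "h = qperm Q z" by auto
  show ?case
    using z qsym_distrib[OF z(1) incl(2,3)] incl(2,3) by (simp add: qperm_def qsym_closed)
next
  case (inv h)
  then obtain z where z: "z \<in> carrier Q" "h = qperm Q z" by auto
  have h: "h \<in> carrier (Inn Q)" using z by (simp add: qperm_in_Inn)
  have inv_eq: "inv\<^bsub>BijGroup (carrier Q)\<^esub> h = inv\<^bsub>Inn Q\<^esub> h"
    unfolding Inn_def
    by (rule group.inv_subgroup_generated[OF group_BijGroup, symmetric]) (use h in \<open>simp add: Inn_def\<close>)
  define k where "k = inv\<^bsub>Inn Q\<^esub> h"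
  have k: "k \<in> carrier (Inn Q)" unfolding k_def using h group.inv_closed[OF group_Inn] by blast
  have kx: "k x \<in> carrier Q" "k y \<in> carrier Q" using Inn_closed[OF k] inv by auto
  have "h (qsym Q (k x) (k y)) = qsym Q (h (k x)) (h (k y))"
    using z qsym_distrib[OF z(1) kx] kx by (simp add: qperm_def qsym_closed)
  also have "\<dots> = qsym Q x y" using inv_Inn(2)[OF h] inv by (simp add: k_def)
  finally have "k (qsym Q x y) = k (h (qsym Q (k x) (k y)))" by simp
  also have "\<dots> = qsym Q (k x) (k y)"
    unfolding k_def by (rule inv_Inn(1)[OF h]) (use kx in \<open>simp add: qsym_closed k_def\<close>)
  finally show ?case by (simp add: inv_eq k_def)
next
  case (eng h1 h2)
  have h: "h1 \<in> carrier (Inn Q)" "h2 \<in> carrier (Inn Q)" using eng(1,2) by (simp_all add: carrier_Inn)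
  then have B: "h1 \<in> Bij (carrier Q)" "h2 \<in> Bij (carrier Q)" using Inn_subset_Bij by auto
  show ?case
    using eng.prems eng.IH B Inn_closed[OF h(2)]
    by (simp add: BijGroup_def compose_eq qsym_closed)
qed

lemma quot_map_apply:
  assumes "N \<lhd> Inn Q" "x \<in> carrier Q" "g \<in> N"
  shows "quot_map Q N (g x) = quot_map Q N x"
proof -
  interpret I: group "Inn Q" by (rule group_Inn)
  interpret N: normal N "Inn Q" by (rule assms)
  have sub: "a \<in> carrier (Inn Q)" if "a \<in> N" for a using that by (rule N.mem_carrier)
  have "\<exists>a\<in>N. h (g x) = a x" if "h \<in> N" for h
    using that assms sub N.m_closed[OF that assms(3)]
    by (intro bexI[of _ "h \<otimes>\<^bsub>Inn Q\<^esub> g"]) (simp_all add: mult_Inn compose_eq)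
  moreover have "\<exists>a\<in>N. h x = a (g x)" if "h \<in> N" for h
    using that assms sub N.m_closed[OF that N.m_inv_closed[OF assms(3)]] inv_Inn(1)[OF sub[OF assms(3)]]
      Inn_closed[OF sub[OF assms(3)]]
    by (intro bexI[of _ "h \<otimes>\<^bsub>Inn Q\<^esub> inv\<^bsub>Inn Q\<^esub> g"]) (simp_all add: mult_Inn compose_eq)
  ultimately show ?thesis unfolding quot_map_def orbit_def by force
qed

lemma quot_qsym_eq:
  assumes "N \<lhd> Inn Q" "x \<in> carrier Q" "y \<in> carrier Q"
  shows "qsym (quot_quandle Q N) (quot_map Q N x) (quot_map Q N y) = quot_map Q N (qsym Q x y)"
proof -
  interpret I: group "Inn Q" by (rule group_Inn)
  interpret N: normal N "Inn Q" by (rule assms)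
  have sub: "a \<in> carrier (Inn Q)" if "a \<in> N" for a using that by (rule N.mem_carrier)
  have ne: "quot_map Q N z \<noteq> {}" for z
  proof -
    have "\<one>\<^bsub>Inn Q\<^esub> \<in> N" by (rule subgroup.one_closed[OF N.subgroup_axioms])
    then have "\<one>\<^bsub>Inn Q\<^esub> z \<in> quot_map Q N z" unfolding quot_map_def orbit_def by auto
    then show ?thesis by blast
  qed
  have *: "quot_map Q N (qsym Q (g x) (h y)) = quot_map Q N (qsym Q x y)" if gh: "g \<in> N" "h \<in> N" for g h
  proof -
    define k where "k = inv\<^bsub>Inn Q\<^esub> g \<otimes>\<^bsub>Inn Q\<^esub> h"
    have k: "k \<in> N" using gh by (simp add: k_def)
    have ky: "g (k y) = h y"
      using sub[OF gh(1)] sub[OF gh(2)] assms(3) Inn_closed[OF sub[OF gh(2)] assms(3)]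
        inv_Inn(2)[OF sub[OF gh(1)]]
      by (simp add: k_def mult_Inn compose_eq)
    define p where "p = qperm Q x"
    have p: "p \<in> carrier (Inn Q)" "\<And>z. z \<in> carrier Q \<Longrightarrow> p z = qsym Q x z"
      unfolding p_def by (rule qperm_in_Inn[OF assms(2)]) (simp add: qperm_def)
    define m where "m = p \<otimes>\<^bsub>Inn Q\<^esub> k \<otimes>\<^bsub>Inn Q\<^esub> inv\<^bsub>Inn Q\<^esub> p"
    have m: "m \<in> N" unfolding m_def using p(1) k by (rule N.inv_op_closed2)
    have kyc: "k y \<in> carrier Q" by (rule Inn_closed[OF sub[OF k] assms(3)])
    have ipc: "(inv\<^bsub>Inn Q\<^esub> p) (p y) = y" by (rule inv_Inn(1)[OF p(1) assms(3)])
    have pyc: "p y \<in> carrier Q" using p assms by (simp add: qsym_closed)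
    have "m (p y) = p (k y)"
      using p(1) sub[OF k] pyc ipc assms(3) I.m_closed[OF p(1) sub[OF k]]
      by (simp add: m_def mult_Inn compose_eq)
    then have mm: "qsym Q x (k y) = m (qsym Q x y)" using p kyc assms by simp
    have "qsym Q (g x) (h y) = g (qsym Q x (k y))"
      using Inn_qsym[OF sub[OF gh(1)] assms(2) kyc] ky by simp
    also have "quot_map Q N \<dots> = quot_map Q N (m (qsym Q x y))"
      using quot_map_apply[OF assms(1) qsym_closed[OF assms(2) kyc] gh(1)] mm by simp
    also have "\<dots> = quot_map Q N (qsym Q x y)"
      by (rule quot_map_apply[OF assms(1) qsym_closed[OF assms(2,3)] m])
    finally show ?thesis .
  qed
  have "quot_map Q N (qsym Q a b) = quot_map Q N (qsym Q x y)"
    if ab: "a \<in> quot_map Q N x" "b \<in> quot_map Q N y" for a b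
  proof -
    obtain g h where "g \<in> N" "h \<in> N" "a = g x" "b = h y"
      using ab unfolding quot_map_def orbit_def by auto
    with *[of g h] show ?thesis by simp
  qed
  then have "(\<Union>a\<in>quot_map Q N x. \<Union>b\<in>quot_map Q N y. quot_map Q N (qsym Q a b)) =
      (\<Union>a\<in>quot_map Q N x. \<Union>b\<in>quot_map Q N y. quot_map Q N (qsym Q x y))"
    by (intro SUP_cong refl)
  also have "\<dots> = quot_map Q N (qsym Q x y)" using ne[of x] ne[of y] by (simp only: UN_constant if_False)
  finally show ?thesis by (simp only: quot_quandle_def quandle.simps)
qed

end

end

theory Submission
  imports Defs
begin

text \<open>The maps \<open>f\<close> and \<open>\<pi>\<^sub>N\<close> matter only through their kernel relations. For normal \<open>N\<close> one has
  \<open>Trans\<^sub>r\<^sub>e\<^sub>l \<pi>\<^sub>N = [Inn P, N]\<close>, so perfect subgroups are recovered from their quotients. Conversely the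
  fibers of a strongly connected \<open>f\<close> are the orbits of \<open>T = Trans\<^sub>r\<^sub>e\<^sub>l f\<close>; hence \<open>f\<close> and \<open>\<pi>\<^sub>T\<close> have the
  same kernel relation, and \<open>T = Trans\<^sub>r\<^sub>e\<^sub>l \<pi>\<^sub>T = [Inn P, T]\<close>.\<close>

section \<open>Conjugation in the inner automorphism group and relative transvections\<close>

context quandle
begin

text \<open>Inner automorphisms respect the operation (\<open>Inn_qsym\<close>), so \<open>g\<close>
  after \<open>qperm Q x\<close> is \<open>qperm Q (g x)\<close> after \<open>g\<close>. This
  translates the action on points into conjugation of generators.\<close>

lemma Inn_apply_qperm:
  assumes g: "g \<in> carrier (Inn Q)" and x: "x \<in> carrier Q"
  shows "g \<otimes>\<^bsub>Inn Q\<^esub> qperm Q x \<otimes>\<^bsub>Inn Q\<^esub> inv\<^bsub>Inn Q\<^esub> g = qperm Q (g x)"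
proof -
  interpret group "Inn Q" by (rule group_Inn)
  note [simp] = qperm_in_Inn Inn_closed
  have "compose (carrier Q) g (qperm Q x) = compose (carrier Q) (qperm Q (g x)) g"
    using g x by (auto simp: compose_def qperm_def Inn_qsym)
  then have "g \<otimes>\<^bsub>Inn Q\<^esub> qperm Q x = qperm Q (g x) \<otimes>\<^bsub>Inn Q\<^esub> g"
    using g x by (simp add: mult_Inn)
  then show ?thesis using g x by (simp add: m_assoc)
qed

lemma mem_Trans_rel_gen:
  assumes "x \<in> carrier Q" "y \<in> carrier Q" "f x = f y"
  shows "qperm Q x \<otimes>\<^bsub>Inn Q\<^esub> inv\<^bsub>Inn Q\<^esub> qperm Q y \<in> Trans_rel Q f"
  unfolding Trans_rel_def using assms by (intro generate.incl) blast

text \<open>The generators see \<open>f\<close> only through its kernel relation, so maps into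
  codomains of different types can be compared.\<close>

lemma Trans_rel_cong:
  assumes "\<And>x y. x \<in> carrier Q \<Longrightarrow> y \<in> carrier Q \<Longrightarrow> f x = f y \<longleftrightarrow> f' x = f' y"
  shows "Trans_rel Q f = Trans_rel Q f'"
proof -
  have "{qperm Q x \<otimes>\<^bsub>Inn Q\<^esub> inv\<^bsub>Inn Q\<^esub> (qperm Q y) | x y.
      x \<in> carrier Q \<and> y \<in> carrier Q \<and> f x = f y} =
    {qperm Q x \<otimes>\<^bsub>Inn Q\<^esub> inv\<^bsub>Inn Q\<^esub> (qperm Q y) | x y.
      x \<in> carrier Q \<and> y \<in> carrier Q \<and> f' x = f' y}"
    using assms by blast
  then show ?thesis by (simp add: Trans_rel_def)
qed

text \<open>Conjugation by \<open>g\<close> sends the generator of a pair \<open>(x, y)\<close> to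
  that of \<open>(g x, g y)\<close>, so an invariant kernel relation makes the generating set stable
  under conjugation. The hypothesis is phrased to suit orbit maps and homomorphisms alike.\<close>

lemma Trans_rel_normal:
  assumes f: "\<And>g x y. \<lbrakk>g \<in> carrier (Inn Q); x \<in> carrier Q; y \<in> carrier Q; f x = f y\<rbrakk> \<Longrightarrow> f (g x) = f (g y)"
  shows "Trans_rel Q f \<lhd> Inn Q"
proof -
  interpret group "Inn Q" by (rule group_Inn)
  note [simp] = qperm_in_Inn Inn_closed
  show ?thesis unfolding Trans_rel_def
  proof (rule normal_generateI)
    show "{qperm Q x \<otimes>\<^bsub>Inn Q\<^esub> inv\<^bsub>Inn Q\<^esub> qperm Q y |x y.
        x \<in> carrier Q \<and> y \<in> carrier Q \<and> f x = f y} \<subseteq> carrier (Inn Q)"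
      by auto
  next
    fix h g
    assume "h \<in> {qperm Q x \<otimes>\<^bsub>Inn Q\<^esub> inv\<^bsub>Inn Q\<^esub> qperm Q y |x y.
        x \<in> carrier Q \<and> y \<in> carrier Q \<and> f x = f y}"
      and g: "g \<in> carrier (Inn Q)"
    then obtain x y where xy: "x \<in> carrier Q" "y \<in> carrier Q" "f x = f y"
      and h: "h = qperm Q x \<otimes>\<^bsub>Inn Q\<^esub> inv\<^bsub>Inn Q\<^esub> qperm Q y" by blast
    have "g \<otimes>\<^bsub>Inn Q\<^esub> h \<otimes>\<^bsub>Inn Q\<^esub> inv\<^bsub>Inn Q\<^esub> g =
      (g \<otimes>\<^bsub>Inn Q\<^esub> qperm Q x \<otimes>\<^bsub>Inn Q\<^esub> inv\<^bsub>Inn Q\<^esub> g) \<otimes>\<^bsub>Inn Q\<^esub>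
      inv\<^bsub>Inn Q\<^esub> (g \<otimes>\<^bsub>Inn Q\<^esub> qperm Q y \<otimes>\<^bsub>Inn Q\<^esub> inv\<^bsub>Inn Q\<^esub> g)"
      using g xy by (simp add: h m_assoc inv_mult_group inv_solve_left)
    also have "\<dots> = qperm Q (g x) \<otimes>\<^bsub>Inn Q\<^esub> inv\<^bsub>Inn Q\<^esub> qperm Q (g y)"
      using g xy by (simp add: Inn_apply_qperm)
    finally show "g \<otimes>\<^bsub>Inn Q\<^esub> h \<otimes>\<^bsub>Inn Q\<^esub> inv\<^bsub>Inn Q\<^esub> g \<in>
      {qperm Q x \<otimes>\<^bsub>Inn Q\<^esub> inv\<^bsub>Inn Q\<^esub> qperm Q y |x y.
        x \<in> carrier Q \<and> y \<in> carrier Q \<and> f x = f y}"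
      using g xy f[OF g xy] Inn_closed by blast
  qed
qed

text \<open>The induction rule of \<open>generate\<close> speaks of the operations of
  \<open>BijGroup (carrier Q)\<close>; here they are those of \<open>Inn Q\<close>. Inverses are
  taken of arbitrary elements, so that the inverse case comes with an induction hypothesis.\<close>

lemma Inn_induct [consumes 1, case_names one qperm inv mult]:
  assumes g: "g \<in> carrier (Inn Q)"
    and one: "R \<one>\<^bsub>Inn Q\<^esub>"
    and qperm: "\<And>x. x \<in> carrier Q \<Longrightarrow> R (qperm Q x)"
    and inv: "\<And>g. g \<in> carrier (Inn Q) \<Longrightarrow> R g \<Longrightarrow> R (inv\<^bsub>Inn Q\<^esub> g)"
    and mult: "\<And>g h. \<lbrakk>g \<in> carrier (Inn Q); h \<in> carrier (Inn Q); R g; R h\<rbrakk> \<Longrightarrow> R (g \<otimes>\<^bsub>Inn Q\<^esub> h)"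
  shows "R g"
  using g[unfolded carrier_Inn]
proof (induction rule: generate.induct)
  case one
  then show ?case using assms(2) by (simp add: Inn_def)
next
  case (incl h)
  then show ?case using qperm by blast
next
  case (inv h)
  then have h: "h \<in> carrier (Inn Q)" "R h" by (auto simp: qperm_in_Inn qperm)
  have "inv\<^bsub>BijGroup (carrier Q)\<^esub> h = inv\<^bsub>Inn Q\<^esub> h"
    unfolding Inn_def
    by (rule group.inv_subgroup_generated[OF group_BijGroup, symmetric])
      (use h in \<open>simp add: Inn_def\<close>)
  then show ?case using assms(4)[OF h] by simp
next
  case (eng h1 h2)
  then have "R (h1 \<otimes>\<^bsub>Inn Q\<^esub> h2)" by (intro mult) (simp_all add: carrier_Inn)
  then show ?case by (simp add: Inn_def)
qed

section \<open>Orbits of a normal subgroup and the quotient quandle\<close>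

lemma mem_quot_map: "y \<in> quot_map Q N x \<longleftrightarrow> (\<exists>g\<in>N. y = g x)"
  by (auto simp: quot_map_def orbit_def)

lemma quot_map_eq_iff:
  assumes N: "N \<lhd> Inn Q" and x: "x \<in> carrier Q" and y: "y \<in> carrier Q"
  shows "quot_map Q N x = quot_map Q N y \<longleftrightarrow> (\<exists>g\<in>N. y = g x)"
proof
  interpret N: normal N "Inn Q" by (rule N)
  assume eq: "quot_map Q N x = quot_map Q N y"
  have "y \<in> quot_map Q N y" unfolding mem_quot_map
    using y by (intro bexI[of _ "\<one>\<^bsub>Inn Q\<^esub>"] subgroup.one_closed[OF N.subgroup_axioms])
      (simp add: one_Inn)
  then have "y \<in> quot_map Q N x" by (simp only: eq)
  then show "\<exists>g\<in>N. y = g x" by (simp add: mem_quot_map)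
next
  assume "\<exists>g\<in>N. y = g x"
  then show "quot_map Q N x = quot_map Q N y" using quot_map_apply[OF N x] by auto
qed

text \<open>From \<open>y = n x\<close> follows \<open>g y = m (g x)\<close>, where \<open>m\<close>
  is the conjugate of \<open>n\<close> by \<open>g\<close> and lies in \<open>N\<close> by
  normality.\<close>

lemma quot_map_Inn_cong:
  assumes N: "N \<lhd> Inn Q" and g: "g \<in> carrier (Inn Q)" and x: "x \<in> carrier Q" and y: "y \<in> carrier Q"
    and eq: "quot_map Q N x = quot_map Q N y"
  shows "quot_map Q N (g x) = quot_map Q N (g y)"
proof -
  interpret N: normal N "Inn Q" by (rule N)
  obtain n where n: "n \<in> N" "y = n x" using eq quot_map_eq_iff[OF N x y] by auto
  have nc: "n \<in> carrier (Inn Q)" using n by (simp add: N.mem_carrier)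
  have m: "g \<otimes>\<^bsub>Inn Q\<^esub> n \<in> carrier (Inn Q)"
    using g nc by (rule monoid.m_closed[OF group.is_monoid[OF group_Inn]])
  have "g \<otimes>\<^bsub>Inn Q\<^esub> n \<otimes>\<^bsub>Inn Q\<^esub> inv\<^bsub>Inn Q\<^esub> g \<in> N" using g n by (simp add: N.inv_op_closed2)
  moreover have "(g \<otimes>\<^bsub>Inn Q\<^esub> n \<otimes>\<^bsub>Inn Q\<^esub> inv\<^bsub>Inn Q\<^esub> g) (g x) = g y"
    using g nc x n(2) m by (simp add: mult_Inn compose_eq inv_Inn Inn_closed)
  ultimately show ?thesis
    using quot_map_eq_iff[OF N Inn_closed[OF g x] Inn_closed[OF g y]] by metis
qed

lemma quot_map_image: "quot_map Q N ` carrier Q = carrier (quot_quandle Q N)"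
  by (auto simp: quot_quandle_def orbits_def quot_map_def)

text \<open>The quandle laws descend from representatives through \<open>quot_qsym_eq\<close>; only
  bijectivity of the translations needs the group.\<close>

lemma surj_quandle_hom_quot_map:
  assumes N: "N \<lhd> Inn Q"
  shows "surj_quandle_hom Q (quot_quandle Q N) (quot_map Q N)"
proof -
  interpret I: group "Inn Q" by (rule group_Inn)
  let ?q = "quot_map Q N"
  have car: "\<exists>x\<in>carrier Q. A = ?q x" if "A \<in> carrier (quot_quandle Q N)" for A
    using that by (auto simp flip: quot_map_image)
  have cl: "?q x \<in> carrier (quot_quandle Q N)" if "x \<in> carrier Q" for x
    using that by (auto simp flip: quot_map_image)
  have "quandle (quot_quandle Q N)"
  proof
    fix A assume "A \<in> carrier (quot_quandle Q N)"
    then obtain x where x: "x \<in> carrier Q" "A = ?q x" using car by blast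
    \<comment> \<open>As an element of \<open>Inn Q\<close> the translation by \<open>x\<close> has
      an inverse in the group, which by \<open>quot_map_Inn_cong\<close> also acts on orbits. This
      gives injectivity and preimages below.\<close>
    define p where "p = qperm Q x"
    have p: "p \<in> carrier (Inn Q)" "\<And>z. z \<in> carrier Q \<Longrightarrow> qsym Q x z = p z"
      unfolding p_def by (rule qperm_in_Inn[OF x(1)]) (simp add: qperm_def)
    have A: "qsym (quot_quandle Q N) A (?q z) = ?q (p z)" if "z \<in> carrier Q" for z
      using quot_qsym_eq[OF N x(1) that] that by (simp add: x p)
    show "qsym (quot_quandle Q N) A A = A"
      using A[OF x(1)] p(2)[OF x(1)] by (simp add: x qsym_idem)
    show "bij_betw (qsym (quot_quandle Q N) A) (carrier (quot_quandle Q N)) (carrier (quot_quandle Q N))"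
    proof (rule bij_betwI')
      fix B C assume "B \<in> carrier (quot_quandle Q N)" "C \<in> carrier (quot_quandle Q N)"
      then obtain y z where yz: "y \<in> carrier Q" "B = ?q y" "z \<in> carrier Q" "C = ?q z"
        using car by meson
      show "qsym (quot_quandle Q N) A B = qsym (quot_quandle Q N) A C \<longleftrightarrow> B = C"
      proof
        assume "qsym (quot_quandle Q N) A B = qsym (quot_quandle Q N) A C"
        then have "?q (p y) = ?q (p z)" using yz A by simp
        then have "?q ((inv\<^bsub>Inn Q\<^esub> p) (p y)) = ?q ((inv\<^bsub>Inn Q\<^esub> p) (p z))"
          using quot_map_Inn_cong[OF N I.inv_closed[OF p(1)]
            Inn_closed[OF p(1) yz(1)] Inn_closed[OF p(1) yz(3)]] by blast
        then show "B = C" using p yz by (simp add: inv_Inn)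
      qed simp
    next
      fix B assume "B \<in> carrier (quot_quandle Q N)"
      then obtain y where y: "y \<in> carrier Q" "B = ?q y" using car by blast
      show "qsym (quot_quandle Q N) A B \<in> carrier (quot_quandle Q N)"
        using y A cl[OF Inn_closed[OF p(1) y(1)]] by simp
      have c: "(inv\<^bsub>Inn Q\<^esub> p) y \<in> carrier Q" using p y by (simp add: Inn_closed)
      have "B = qsym (quot_quandle Q N) A (?q ((inv\<^bsub>Inn Q\<^esub> p) y))"
        using y A[OF c] p by (simp add: inv_Inn)
      then show "\<exists>C\<in>carrier (quot_quandle Q N). B = qsym (quot_quandle Q N) A C"
        using cl[OF c] by blast
    qed
  next
    fix A B C
    assume "A \<in> carrier (quot_quandle Q N)" "B \<in> carrier (quot_quandle Q N)"
      "C \<in> carrier (quot_quandle Q N)"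
    then obtain x y z where xyz: "x \<in> carrier Q" "y \<in> carrier Q" "z \<in> carrier Q"
      and "A = ?q x" "B = ?q y" "C = ?q z" using car by meson
    then show "qsym (quot_quandle Q N) A (qsym (quot_quandle Q N) B C) =
      qsym (quot_quandle Q N) (qsym (quot_quandle Q N) A B) (qsym (quot_quandle Q N) A C)"
      using qsym_distrib[OF xyz] xyz by (simp add: quot_qsym_eq[OF N] qsym_closed)
  qed
  then have "quandle_hom Q (quot_quandle Q N) ?q"
    using cl quandle_axioms
    by (auto simp: quandle_hom_def quandle_hom_axioms_def quot_qsym_eq[OF N])
  then show ?thesis by (simp add: surj_quandle_hom_def quot_map_image)
qed

text \<open>If \<open>y = n x\<close> with \<open>n \<in> N\<close>, then \<open>s\<^sub>x s\<^sub>y\<^sup>-\<^sup>1\<close> is the commutator of \<open>s\<^sub>x\<close> and \<open>n\<close>. Modulo the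
  normal subgroup generated by these, every generator of the inner automorphism group
  centralizes \<open>N\<close>, hence so does the whole group.\<close>

lemma Trans_rel_quot_map:
  assumes N: "N \<lhd> Inn Q"
  shows "Trans_rel Q (quot_map Q N) = mutual_commutator (Inn Q) (carrier (Inn Q)) N"
    (is "?T = ?C")
proof
  interpret I: group "Inn Q" by (rule group_Inn)
  interpret N: normal N "Inn Q" by (rule N)
  \<comment> \<open>Normality absorbs the conjugates that arise when commutators with inverses and
    products are expanded.\<close>
  interpret T: normal ?T "Inn Q"
    by (rule Trans_rel_normal) (rule quot_map_Inn_cong[OF N])
  note [simp] = qperm_in_Inn Inn_closed N.mem_carrier T.mem_carrier
  let ?c = "\<lambda>g n. g \<otimes>\<^bsub>Inn Q\<^esub> n \<otimes>\<^bsub>Inn Q\<^esub> inv\<^bsub>Inn Q\<^esub> g \<otimes>\<^bsub>Inn Q\<^esub> inv\<^bsub>Inn Q\<^esub> n"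
  have comm: "qperm Q x \<otimes>\<^bsub>Inn Q\<^esub> inv\<^bsub>Inn Q\<^esub> qperm Q (n x) = ?c (qperm Q x) n"
    if "n \<in> N" "x \<in> carrier Q" for n x
    using that by (simp add: Inn_apply_qperm[symmetric] I.inv_mult_group I.m_assoc)
  have C: "subgroup ?C (Inn Q)" unfolding mutual_commutator_def
    by (rule I.generate_is_subgroup) auto
  show "?T \<subseteq> ?C" unfolding Trans_rel_def
  proof (rule I.generate_subgroup_incl[OF _ C], clarify)
    fix x y assume xy: "x \<in> carrier Q" "y \<in> carrier Q" "quot_map Q N x = quot_map Q N y"
    then obtain n where n: "n \<in> N" "y = n x" using quot_map_eq_iff[OF N] by blast
    have "?c (qperm Q x) n \<in> ?C" unfolding mutual_commutator_def
      by (rule generate.incl) (use n xy in auto)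
    then show "qperm Q x \<otimes>\<^bsub>Inn Q\<^esub> inv\<^bsub>Inn Q\<^esub> qperm Q y \<in> ?C" using comm n xy by simp
  qed
  have "?c g n \<in> ?T" if g: "g \<in> carrier (Inn Q)" and n: "n \<in> N" for g n
    using g
  proof (induction rule: Inn_induct)
    case one
    then show ?case using n subgroup.one_closed[OF T.subgroup_axioms] by simp
  next
    case (qperm x)
    have "quot_map Q N x = quot_map Q N (n x)" using quot_map_apply[OF N qperm n] by simp
    then have "qperm Q x \<otimes>\<^bsub>Inn Q\<^esub> inv\<^bsub>Inn Q\<^esub> qperm Q (n x) \<in> ?T"
      using qperm n by (intro mem_Trans_rel_gen) simp_all
    then show ?case using comm[OF n qperm] by simp
  next
    case (inv g)
    have "?c (inv\<^bsub>Inn Q\<^esub> g) n = inv\<^bsub>Inn Q\<^esub> g \<otimes>\<^bsub>Inn Q\<^esub> inv\<^bsub>Inn Q\<^esub> (?c g n) \<otimes>\<^bsub>Inn Q\<^esub> g"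
      using inv(1) n by (simp add: I.inv_mult_group I.m_assoc)
    also have "\<dots> \<in> ?T" using inv by (intro T.inv_op_closed1) simp_all
    finally show ?case .
  next
    case (mult g h)
    have cancel: "inv\<^bsub>Inn Q\<^esub> a \<otimes>\<^bsub>Inn Q\<^esub> (a \<otimes>\<^bsub>Inn Q\<^esub> b) = b"
      if "a \<in> carrier (Inn Q)" "b \<in> carrier (Inn Q)" for a b
      using that by (simp flip: I.m_assoc)
    have cancel': "a \<otimes>\<^bsub>Inn Q\<^esub> (inv\<^bsub>Inn Q\<^esub> a \<otimes>\<^bsub>Inn Q\<^esub> b) = b"
      if "a \<in> carrier (Inn Q)" "b \<in> carrier (Inn Q)" for a b
      using that by (simp flip: I.m_assoc)
    \<comment> \<open>The standard expansion [gh, n] = g [h, n] g^-1 [g, n]; its first factor stays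
      in \<open>?T\<close> by normality.\<close>
    have "?c (g \<otimes>\<^bsub>Inn Q\<^esub> h) n =
      (g \<otimes>\<^bsub>Inn Q\<^esub> ?c h n \<otimes>\<^bsub>Inn Q\<^esub> inv\<^bsub>Inn Q\<^esub> g) \<otimes>\<^bsub>Inn Q\<^esub> ?c g n"
      using mult(1,2) n by (simp add: I.inv_mult_group I.m_assoc cancel cancel')
    also have "\<dots> \<in> ?T" by (rule T.m_closed[OF T.inv_op_closed2[OF mult(1,4)] mult(3)])
    finally show ?case .
  qed
  then show "?C \<subseteq> ?T" unfolding mutual_commutator_def
    by (intro I.generate_subgroup_incl T.subgroup_axioms) auto
qed

end

section \<open>Kernel relations of homomorphisms under inner automorphisms\<close>

context quandle_hom
begin

text \<open>With \<open>z\<close> written as \<open>qsym P y w\<close>, the points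
  \<open>qsym P x w\<close> and \<open>qsym P y w\<close> have the same image, since
  \<open>f x = f y\<close> act on \<open>f w\<close> by one translation. These products are the
  generators of \<open>Trans_rel P f\<close>.\<close>

lemma hom_qperm_mult_inv:
  assumes "x \<in> carrier P" "y \<in> carrier P" "f x = f y" "z \<in> carrier P"
  shows "f ((qperm P x \<otimes>\<^bsub>Inn P\<^esub> inv\<^bsub>Inn P\<^esub> qperm P y) z) = f z"
proof -
  interpret I: group "Inn P" by (rule dom.group_Inn)
  define w where "w = (inv\<^bsub>Inn P\<^esub> qperm P y) z"
  have w: "w \<in> carrier P" using assms by (simp add: w_def dom.Inn_closed dom.qperm_in_Inn)
  have z: "qperm P y w = z" unfolding w_def using assms by (simp add: dom.inv_Inn dom.qperm_in_Inn)
  have "(qperm P x \<otimes>\<^bsub>Inn P\<^esub> inv\<^bsub>Inn P\<^esub> qperm P y) z = qsym P x w"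
    using assms w by (simp add: dom.mult_Inn dom.qperm_in_Inn compose_eq flip: w_def)
      (simp add: qperm_def)
  also have "f \<dots> = f (qsym P y w)" using assms w by (simp add: hom_qsym)
  also have "qsym P y w = z" using z w by (simp add: qperm_def)
  finally show ?thesis .
qed

text \<open>Under \<open>f\<close> a generator becomes a translation of \<open>Q\<close>, which is
  injective. An equivalence rather than one implication is what the inverse case needs: the
  hypothesis for \<open>g\<close> is applied at the images of \<open>x\<close> and \<open>y\<close>
  under its inverse.\<close>

lemma Inn_cong:
  assumes g: "g \<in> carrier (Inn P)"
    and "x \<in> carrier P" "y \<in> carrier P"
  shows "f (g x) = f (g y) \<longleftrightarrow> f x = f y"
  using assms
proof (induction arbitrary: x y rule: dom.Inn_induct)
  case one
  then show ?case by (simp add: dom.one_Inn)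
next
  case (qperm z)
  have "inj_on (qsym Q (f z)) (carrier Q)"
    using cod.qsym_bij hom_closed qperm by (auto simp: bij_betw_def)
  then show ?case using qperm hom_closed
    by (auto simp: qperm_def hom_qsym dest: inj_onD)
next
  case (inv g)
  interpret I: group "Inn P" by (rule dom.group_Inn)
  have "(inv\<^bsub>Inn P\<^esub> g) x \<in> carrier P" "(inv\<^bsub>Inn P\<^esub> g) y \<in> carrier P"
    using inv by (simp_all add: dom.Inn_closed)
  then show ?case using inv(2) inv by (metis dom.inv_Inn(2))
next
  case (mult g h)
  then show ?case by (simp add: dom.mult_Inn compose_eq dom.Inn_closed)
qed

lemma Trans_rel_normal_hom: "Trans_rel P f \<lhd> Inn P"
  by (rule dom.Trans_rel_normal) (simp add: Inn_cong)

text \<open>The elements preserving every fiber form a subgroup, which contains the generators by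
  \<open>hom_qperm_mult_inv\<close>.\<close>

lemma Trans_rel_fiber:
  assumes g: "g \<in> Trans_rel P f" and "x \<in> carrier P"
  shows "f (g x) = f x"
proof -
  interpret I: group "Inn P" by (rule dom.group_Inn)
  let ?S = "{g \<in> carrier (Inn P). \<forall>x\<in>carrier P. f (g x) = f x}"
  have "subgroup ?S (Inn P)"
  proof
    show "\<one>\<^bsub>Inn P\<^esub> \<in> ?S" using I.one_closed by (simp add: dom.one_Inn)
  next
    fix g h assume "g \<in> ?S" "h \<in> ?S"
    moreover have "g \<otimes>\<^bsub>Inn P\<^esub> h \<in> carrier (Inn P)" using calculation by simp
    ultimately show "g \<otimes>\<^bsub>Inn P\<^esub> h \<in> ?S"
      by (simp add: dom.mult_Inn compose_eq dom.Inn_closed)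
  next
    fix g assume g: "g \<in> ?S"
    have "f ((inv\<^bsub>Inn P\<^esub> g) x) = f x" if "x \<in> carrier P" for x
    proof -
      have "(inv\<^bsub>Inn P\<^esub> g) x \<in> carrier P" using g that by (simp add: dom.Inn_closed)
      then have "f (g ((inv\<^bsub>Inn P\<^esub> g) x)) = f ((inv\<^bsub>Inn P\<^esub> g) x)" using g by blast
      then show ?thesis using g that by (simp add: dom.inv_Inn)
    qed
    then show "inv\<^bsub>Inn P\<^esub> g \<in> ?S" using g by simp
  qed auto
  then have "Trans_rel P f \<subseteq> ?S" unfolding Trans_rel_def
    by (rule I.generate_subgroup_incl[rotated])
      (use hom_qperm_mult_inv in \<open>auto simp: dom.qperm_in_Inn\<close>)
  then show ?thesis using assms by blast
qed

end

section \<open>Quotients up to isomorphism as kernel relations\<close>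

lemma surj_quandle_homD:
  assumes "surj_quandle_hom P Q f"
  shows "quandle_hom P Q f" "f ` carrier P = carrier Q"
  using assms by (simp_all add: surj_quandle_hom_def)

text \<open>An isomorphism of quotients is forced to send \<open>f x\<close> to \<open>f' x\<close>;
  equal kernels make this well defined and injective. Comparing quotients thereby reduces to
  comparing relations on \<open>carrier P\<close>.\<close>

lemma quotient_iso_iff_same_kernel:
  assumes f: "surj_quandle_hom P Q f" and f': "surj_quandle_hom P Q' f'"
  shows "quotient_iso P Q f Q' f' \<longleftrightarrow>
    (\<forall>x\<in>carrier P. \<forall>y\<in>carrier P. f x = f y \<longleftrightarrow> f' x = f' y)"
proof
  assume "quotient_iso P Q f Q' f'"
  then obtain t where t: "bij_betw t (carrier Q) (carrier Q')" "\<And>x. x \<in> carrier P \<Longrightarrow> t (f x) = f' x"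
    by (auto simp: quotient_iso_def quandle_iso_def)
  show "\<forall>x\<in>carrier P. \<forall>y\<in>carrier P. f x = f y \<longleftrightarrow> f' x = f' y"
  proof (intro ballI)
    fix x y assume xy: "x \<in> carrier P" "y \<in> carrier P"
    then have "f x \<in> carrier Q" "f y \<in> carrier Q" using surj_quandle_homD(2)[OF f] by auto
    then show "f x = f y \<longleftrightarrow> f' x = f' y"
      using t(2)[OF xy(1)] t(2)[OF xy(2)] bij_betw_imp_inj_on[OF t(1)] by (metis inj_onD)
  qed
next
  assume ker: "\<forall>x\<in>carrier P. \<forall>y\<in>carrier P. f x = f y \<longleftrightarrow> f' x = f' y"
  interpret f: quandle_hom P Q f by (rule surj_quandle_homD(1)[OF f])
  interpret f': quandle_hom P Q' f' by (rule surj_quandle_homD(1)[OF f'])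
  note im = surj_quandle_homD(2)[OF f] surj_quandle_homD(2)[OF f']
  \<comment> \<open>The preimage under \<open>f\<close> is arbitrary; equality of the kernels
    removes the dependence on the choice.\<close>
  define t where "t q = f' (inv_into (carrier P) f q)" for q
  have t: "t (f x) = f' x" if "x \<in> carrier P" for x
  proof -
    have "inv_into (carrier P) f (f x) \<in> carrier P" "f (inv_into (carrier P) f (f x)) = f x"
      using that by (auto intro: inv_into_into f_inv_into_f)
    then show ?thesis using ker that by (simp add: t_def)
  qed
  have "quandle_hom Q Q' t"
  proof
    show "t \<in> carrier Q \<rightarrow> carrier Q'" using t im by force
  next
    fix q r assume "q \<in> carrier Q" "r \<in> carrier Q"
    then obtain x y where xy: "x \<in> carrier P" "y \<in> carrier P" "q = f x" "r = f y"
      using im by (metis imageE)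
    have "qsym Q q r = f (qsym P x y)" using xy by (simp add: f.hom_qsym)
    then have "t (qsym Q q r) = f' (qsym P x y)" using xy t f.dom.qsym_closed by simp
    then show "t (qsym Q q r) = qsym Q' (t q) (t r)" using xy t by (simp add: f'.hom_qsym)
  qed
  moreover have "bij_betw t (carrier Q) (carrier Q')"
  proof (rule bij_betw_imageI)
    show "inj_on t (carrier Q)"
      unfolding im(1)[symmetric] using t ker by (auto intro!: inj_onI)
    have "t ` f ` carrier P = f' ` carrier P" unfolding image_image by (rule image_cong[OF refl t])
    then show "t ` carrier Q = carrier Q'" by (simp only: im)
  qed
  ultimately show "quotient_iso P Q f Q' f'" unfolding quotient_iso_def quandle_iso_def using t by blast
qed

section \<open>Strongly connected quotients and perfect normal subgroups\<close>

lemma strongly_connected_fiber_iff: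
  assumes f: "strongly_connected P Q f" and xy: "x \<in> carrier P" "y \<in> carrier P"
  shows "f x = f y \<longleftrightarrow> (\<exists>g\<in>Trans_rel P f. y = g x)"
proof -
  interpret quandle_hom P Q f
    using f by (simp add: strongly_connected_def surj_quandle_hom_def)
  show ?thesis using f xy Trans_rel_fiber by (metis strongly_connected_def)
qed

text \<open>For surjective homomorphisms, the transvection group and its transitivity on fibers
  depend only on the kernel relation, which isomorphic quotients share.\<close>

lemma strongly_connected_cong:
  assumes f: "surj_quandle_hom P Q f" and f': "surj_quandle_hom P Q' f'"
    and iso: "quotient_iso P Q f Q' f'"
  shows "Trans_rel P f = Trans_rel P f'"
    and "strongly_connected P Q f \<longleftrightarrow> strongly_connected P Q' f'"
proof -
  interpret quandle_hom P Q f by (rule surj_quandle_homD(1)[OF f])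
  have ker: "f x = f y \<longleftrightarrow> f' x = f' y" if "x \<in> carrier P" "y \<in> carrier P" for x y
    using iso quotient_iso_iff_same_kernel[OF f f'] that by blast
  then show T: "Trans_rel P f = Trans_rel P f'" by (rule dom.Trans_rel_cong)
  show "strongly_connected P Q f \<longleftrightarrow> strongly_connected P Q' f'"
    using ker f f' T by (simp add: strongly_connected_def)
qed

text \<open>By perfectness the commutator formula \<open>Trans_rel_quot_map\<close> returns
  \<open>N\<close> itself, and \<open>N\<close> is transitive on its own orbits, the fibers of
  \<open>quot_map P N\<close>.\<close>

lemma strongly_connected_quot_map:
  assumes P: "quandle P" and N: "N \<in> perfect_normals P"
  shows "strongly_connected P (quot_quandle P N) (quot_map P N)"
    and "Trans_rel P (quot_map P N) = N"
proof -
  interpret quandle P by fact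
  have N: "N \<lhd> Inn P" "Inn_perfect P N" using N by (simp_all add: perfect_normals_def)
  show T: "Trans_rel P (quot_map P N) = N"
    using N Trans_rel_quot_map by (simp add: Inn_perfect_def)
  show "strongly_connected P (quot_quandle P N) (quot_map P N)"
    using surj_quandle_hom_quot_map[OF N(1)] quot_map_eq_iff[OF N(1)]
    by (auto simp: strongly_connected_def T)
qed

lemma strongly_connected_Trans_rel:
  assumes f: "strongly_connected P Q f"
  shows "Trans_rel P f \<in> perfect_normals P"
    and "quotient_iso P Q f (quot_quandle P (Trans_rel P f)) (quot_map P (Trans_rel P f))"
proof -
  have s: "surj_quandle_hom P Q f" using f by (simp add: strongly_connected_def)
  interpret quandle_hom P Q f by (rule surj_quandle_homD(1)[OF s])
  let ?T = "Trans_rel P f"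
  note T = Trans_rel_normal_hom
  note s' = dom.surj_quandle_hom_quot_map[OF T]
  \<comment> \<open>Both kernel relations are the orbit relation of \<open>?T\<close>: for
    \<open>f\<close> by strong connectedness, for the orbit map by
    \<open>quot_map_eq_iff\<close>.\<close>
  show iso: "quotient_iso P Q f (quot_quandle P ?T) (quot_map P ?T)"
    using quotient_iso_iff_same_kernel[OF s s']
    by (simp add: strongly_connected_fiber_iff[OF f] dom.quot_map_eq_iff[OF T])
  \<comment> \<open>Along \<open>iso\<close> the group \<open>?T\<close> is also the transvection
    group of \<open>quot_map P ?T\<close>, hence the commutator subgroup of \<open>Inn P\<close>
    with \<open>?T\<close>.\<close>
  have "Inn_perfect P ?T"
    using strongly_connected_cong(1)[OF s s' iso] dom.Trans_rel_quot_map[OF T]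
    by (simp add: Inn_perfect_def)
  then show "?T \<in> perfect_normals P" using T by (simp add: perfect_normals_def)
qed

text \<open>The fibers of a strongly connected map are the orbits of its transvection group, so this
  group determines the kernel relation. The two codomains may have different types.\<close>

lemma quotient_iso_iff_Trans_rel_eq:
  assumes f: "strongly_connected P Q f" and f': "strongly_connected P Q' f'"
  shows "quotient_iso P Q f Q' f' \<longleftrightarrow> Trans_rel P f = Trans_rel P f'"
proof -
  have s: "surj_quandle_hom P Q f" "surj_quandle_hom P Q' f'"
    using f f' by (simp_all add: strongly_connected_def)
  show ?thesis
    using strongly_connected_cong(1)[OF s] quotient_iso_iff_same_kernel[OF s]
      strongly_connected_fiber_iff[OF f] strongly_connected_fiber_iff[OF f'] by auto
qed

text \<open>The witness is \<open>Trans_rel P f\<close>; conversely, strong connectedness of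
  \<open>quot_map P N\<close> is carried back along the isomorphism.\<close>

lemma strongly_connected_iff_perfect_quotient:
  assumes s: "surj_quandle_hom P Q f"
  shows "strongly_connected P Q f \<longleftrightarrow>
    (\<exists>N\<in>perfect_normals P. quotient_iso P Q f (quot_quandle P N) (quot_map P N))"
proof
  assume "strongly_connected P Q f"
  then show "\<exists>N\<in>perfect_normals P. quotient_iso P Q f (quot_quandle P N) (quot_map P N)"
    using strongly_connected_Trans_rel by blast
next
  interpret quandle_hom P Q f by (rule surj_quandle_homD(1)[OF s])
  assume "\<exists>N\<in>perfect_normals P. quotient_iso P Q f (quot_quandle P N) (quot_map P N)"
  then obtain N where N: "N \<in> perfect_normals P"
    and iso: "quotient_iso P Q f (quot_quandle P N) (quot_map P N)" by blast
  have sc: "strongly_connected P (quot_quandle P N) (quot_map P N)"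
    by (rule strongly_connected_quot_map(1)[OF dom.quandle_axioms N])
  then show "strongly_connected P Q f"
    using strongly_connected_cong(2)[OF s _ iso] by (simp add: strongly_connected_def)
qed

section \<open>Isomorphism classes and the bijection\<close>

definition class_Trans_rel ::
  "('a, 'm) quandle_scheme \<Rightarrow> ('b quandle \<times> ('a \<Rightarrow> 'b)) set \<Rightarrow> ('a \<Rightarrow> 'a) set" where
  "class_Trans_rel P C = the_elem ((\<lambda>(Q, f). Trans_rel P f) ` C)"

text \<open>All members of a class share one transvection group, so the image is a singleton and
  \<open>the_elem\<close> reads it off without choosing a representative.\<close>

lemma class_Trans_rel_sc_class:
  assumes f: "strongly_connected P Q f"
  shows "class_Trans_rel P (sc_class P Q f) = Trans_rel P f"
proof -
  have mem: "(Q', f') \<in> sc_class P Q f \<longleftrightarrow> strongly_connected P Q' f' \<and> quotient_iso P Q f Q' f'"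
    for Q' f'
    using f by (auto simp: sc_class_def sc_quotient_iso_rel_def sc_quotients_def)
  \<comment> \<open>Reflexivity puts \<open>(Q, f)\<close> into its own class, so the image is not
    empty.\<close>
  have "quotient_iso P Q f Q f"
    using quotient_iso_iff_Trans_rel_eq[OF f f] by simp
  then have "(\<lambda>(Q, f). Trans_rel P f) ` sc_class P Q f = {Trans_rel P f}"
    using f mem quotient_iso_iff_Trans_rel_eq[OF f] by (auto simp: image_iff) fastforce+
  then show ?thesis by (simp add: class_Trans_rel_def)
qed

lemma sc_class_eq_iff:
  fixes P :: "('a, 'm) quandle_scheme" and Q Q' :: "'b quandle"
  assumes f: "strongly_connected P Q f" and f': "strongly_connected P Q' f'"
  shows "sc_class P Q f = sc_class P Q' f' \<longleftrightarrow> Trans_rel P f = Trans_rel P f'"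
proof -
  have "sc_class P Q f = sc_class P Q' f' \<longleftrightarrow> ((Q, f), (Q', f')) \<in> sc_quotient_iso_rel P"
    unfolding sc_class_def using f f'
    by (intro eq_equiv_class_iff[OF equiv_sc_quotient_iso_rel]) (auto simp: sc_quotients_def)
  also have "\<dots> \<longleftrightarrow> quotient_iso P Q f Q' f'"
    using f f' by (auto simp: sc_quotient_iso_rel_def sc_quotients_def)
  finally show ?thesis using quotient_iso_iff_Trans_rel_eq[OF f f'] by simp
qed

lemma sc_quotient_classesE:
  fixes P :: "('a, 'm) quandle_scheme" and C :: "('b quandle \<times> ('a \<Rightarrow> 'b)) set"
  assumes "C \<in> sc_quotient_classes P"
  obtains Q f where "strongly_connected P Q f" "C = sc_class P Q f"
  using assms by (auto simp: sc_quotient_classes_def sc_class_def sc_quotients_def elim!: quotientE)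

lemma sc_class_in_classes:
  "strongly_connected P Q f \<Longrightarrow> sc_class P Q f \<in> sc_quotient_classes P"
  by (auto simp: sc_quotient_classes_def sc_class_def sc_quotients_def intro!: quotientI)

text \<open>Injectivity holds because the group is a complete invariant of the class. Codomains on
  \<open>'a set\<close> make \<open>quot_quandle P N\<close> itself a representative, which gives
  surjectivity.\<close>

lemma bij_betw_class_Trans_rel:
  fixes P :: "('a, 'm) quandle_scheme"
  assumes P: "quandle P"
  shows "bij_betw (class_Trans_rel P :: ('a set quandle \<times> ('a \<Rightarrow> 'a set)) set \<Rightarrow> _)
    (sc_quotient_classes P) (perfect_normals P)"
proof (rule bij_betwI')
  fix C D :: "('a set quandle \<times> ('a \<Rightarrow> 'a set)) set"
  assume C: "C \<in> sc_quotient_classes P" and D: "D \<in> sc_quotient_classes P"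
  show "class_Trans_rel P C = class_Trans_rel P D \<longleftrightarrow> C = D"
    using C D by (elim sc_quotient_classesE) (simp add: class_Trans_rel_sc_class sc_class_eq_iff)
next
  fix C :: "('a set quandle \<times> ('a \<Rightarrow> 'a set)) set"
  assume "C \<in> sc_quotient_classes P"
  then show "class_Trans_rel P C \<in> perfect_normals P"
    by (elim sc_quotient_classesE) (simp add: class_Trans_rel_sc_class strongly_connected_Trans_rel)
next
  fix N assume N: "N \<in> perfect_normals P"
  note sc = strongly_connected_quot_map[OF P N]
  then show "\<exists>C\<in>sc_quotient_classes P. N = class_Trans_rel P (C :: ('a set quandle \<times> ('a \<Rightarrow> 'a set)) set)"
    by (intro bexI[of _ "sc_class P (quot_quandle P N) (quot_map P N)"])
      (simp_all add: class_Trans_rel_sc_class sc_class_in_classes)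
qed

text \<open>The bijection ranges over quotients carried by \<open>'a set\<close>, where the orbit
  quotients live. The last two conjuncts reach other carrier types: orbit quotients serve as models
  there too, and the transvection group classifies across types.\<close>

theorem theorem0p4:
  fixes P :: "'a quandle"
  assumes "quandle P"
  shows
    "(\<forall>(Q :: 'b quandle) f. surj_quandle_hom P Q f \<longrightarrow>
        (strongly_connected P Q f \<longleftrightarrow>
          (\<exists>N. N \<lhd> Inn P \<and> Inn_perfect P N \<and>
            quotient_iso P Q f (quot_quandle P N) (quot_map P N))))
   \<and> (\<exists>\<Phi> :: ('a set quandle \<times> ('a \<Rightarrow> 'a set)) set \<Rightarrow> ('a \<Rightarrow> 'a) set.
        bij_betw \<Phi> (sc_quotient_classes P) (perfect_normals P)
        \<and> (\<forall>Q f. strongly_connected P Q f \<longrightarrow> \<Phi> (sc_class P Q f) = Trans_rel P f)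
        \<and> (\<forall>N \<in> perfect_normals P.
             strongly_connected P (quot_quandle P N) (quot_map P N)
             \<and> inv_into (sc_quotient_classes P) \<Phi> N
                 = sc_class P (quot_quandle P N) (quot_map P N)))
   \<and> (\<forall>(Q :: 'b quandle) f. strongly_connected P Q f \<longrightarrow>
        Trans_rel P f \<in> perfect_normals P \<and>
        quotient_iso P Q f (quot_quandle P (Trans_rel P f)) (quot_map P (Trans_rel P f)))
   \<and> (\<forall>(Q :: 'b quandle) f (Q' :: 'c quandle) f'.
        strongly_connected P Q f \<and> strongly_connected P Q' f' \<longrightarrow>
        (quotient_iso P Q f Q' f' \<longleftrightarrow> Trans_rel P f = Trans_rel P f'))"
proof (intro conjI allI impI)
  fix Q :: "'b quandle" and f assume "surj_quandle_hom P Q f"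
  then show "strongly_connected P Q f \<longleftrightarrow>
      (\<exists>N. N \<lhd> Inn P \<and> Inn_perfect P N \<and>
        quotient_iso P Q f (quot_quandle P N) (quot_map P N))"
    by (simp add: strongly_connected_iff_perfect_quotient perfect_normals_def Bex_def conj_assoc)
next
  let ?\<Phi> = "class_Trans_rel P :: ('a set quandle \<times> ('a \<Rightarrow> 'a set)) set \<Rightarrow> ('a \<Rightarrow> 'a) set"
  have bij: "bij_betw ?\<Phi> (sc_quotient_classes P) (perfect_normals P)"
    by (rule bij_betw_class_Trans_rel[OF assms])
  \<comment> \<open>The transvection group of \<open>quot_map P N\<close> is \<open>N\<close>, so by
    injectivity its class is the only preimage of \<open>N\<close>.\<close>
  have "inv_into (sc_quotient_classes P) ?\<Phi> N = sc_class P (quot_quandle P N) (quot_map P N)"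
    if N: "N \<in> perfect_normals P" for N
    using strongly_connected_quot_map[OF assms N] bij_betw_imp_inj_on[OF bij]
    by (intro inv_into_f_eq) (simp_all add: class_Trans_rel_sc_class sc_class_in_classes)
  then show "\<exists>\<Phi> :: ('a set quandle \<times> ('a \<Rightarrow> 'a set)) set \<Rightarrow> ('a \<Rightarrow> 'a) set.
      bij_betw \<Phi> (sc_quotient_classes P) (perfect_normals P)
      \<and> (\<forall>Q f. strongly_connected P Q f \<longrightarrow> \<Phi> (sc_class P Q f) = Trans_rel P f)
      \<and> (\<forall>N \<in> perfect_normals P.
           strongly_connected P (quot_quandle P N) (quot_map P N)
           \<and> inv_into (sc_quotient_classes P) \<Phi> N
               = sc_class P (quot_quandle P N) (quot_map P N))"
    using bij class_Trans_rel_sc_class strongly_connected_quot_map(1)[OF assms]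
    by (intro exI[of _ ?\<Phi>]) blast
qed (simp_all add: strongly_connected_Trans_rel quotient_iso_iff_Trans_rel_eq)

end
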